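(* Let $L$ be a left Leibniz algebra over a field $F$ which is not a Lie algebra, and suppose that every subalgebra of $L$ is either an ideal of $L$ or self-idealizing in $L$. Let $K=\mathrm{Ln}(L)$ and suppose that $L\neq K$, that $K$ is not cyclic and that $K$ is not abelian. If $[K,K]\leqslant\zeta(L)$, then $\mathrm{char}(F)=2$ and the following conditions hold: (i) $K$ is a strong extraspecial subalgebra; moreover $[x,x]\neq 0$ for each element $x\in L$ with $x\notin\mathrm{Leib}(L)$; (ii) $[K,K]=\zeta(L)=\mathrm{Leib}(L)$; (iii) for a generator $z$ of the one-dimensional ideal $\mathrm{Leib}(L)=Fz$, one has $L=K+\langle v\rangle$ for some $v\in L$ such that $[v,v]=\eta z$ for some non-zero element $\eta\in F$, and $[v+\zeta(K),x+\zeta(K)]=x+\zeta(K)$ (in $L/\zeta(K)$) for each element $x\in K\setminus\zeta(K)$.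
   Context: A left Leibniz algebra over $F$ is an $F$-vector space $L$ (of arbitrary dimension) with a bilinear bracket satisfying $[[a,b],c]=[a,[b,c]]-[b,[a,c]]$ for all $a,b,c\in L$. It is a Lie algebra iff $[a,a]=0$ for all $a\in L$. Ideals are two-sided. $\langle v\rangle$ is the subalgebra generated by $v$. An algebra is abelian if $[x,y]=0$ for all $x,y$ in it, and cyclic if it is generated as an algebra by one element. For a subalgebra $S$ of $L$, $\mathrm{I}_L(S)=\{x\in L \mid [x,s],[s,x]\in S \text{ for all } s\in S\}$; $S$ is self-idealizing in $L$ if $S=\mathrm{I}_L(S)$. The center is $\zeta(L)=\{x\in L\mid [x,y]=[y,x]=0 \text{ for all } y\in L\}$. $[K,K]$ is the subspace spanned by all $[x,y]$, $x,y\in K$. The Leibniz kernel $\mathrm{Leib}(L)$ is the subspace spanned by all $[a,a]$, $a\in L$; it is an ideal. An algebra is locally nilpotent if every finitely generated subalgebra is nilpotent. Every Leibniz algebra $L$ has a greatest locally nilpotent ideal, the locally nilpotent radical $\mathrm{Ln}(L)$. A Leibniz algebra $E$ is extraspecial if $\zeta(E)$ has dimension $1$ and $E/\zeta(E)$ is abelian; it is strong extraspecial if moreover $[x,x]\neq 0$ for each $x\in E\setminus\zeta(E)$. *)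

theory Defs
  imports Complex_Main "HOL-Library.Set_Algebras"
begin

text \<open>
  The algebra \<open>L\<close> is a whole type \<open>'a\<close>, so \<open>L\<close> is \<open>UNIV\<close>. In what follows \<open>s\<close> is the scalar
  multiplication and \<open>b\<close> the bracket. Notions that are also needed for subalgebras (center, lower
  central series, and so on) take the carrier as a further argument.
\<close>

locale left_leibniz_algebra = vector_space s
  for s :: "'f::field \<Rightarrow> 'a::ab_group_add \<Rightarrow> 'a" +
  fixes b :: "'a \<Rightarrow> 'a \<Rightarrow> 'a"
  assumes linear_left: "Vector_Spaces.linear s s (\<lambda>x. b x y)"
    and linear_right: "Vector_Spaces.linear s s (\<lambda>y. b x y)"
    and leibniz: "b (b x y) z = b x (b y z) - b y (b x z)"

definition is_lie :: "('a::ab_group_add \<Rightarrow> 'a \<Rightarrow> 'a) \<Rightarrow> bool"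
  where "is_lie b \<longleftrightarrow> (\<forall>a. b a a = 0)"

definition leib_subalgebra ::
    "('f::field \<Rightarrow> 'a::ab_group_add \<Rightarrow> 'a) \<Rightarrow> ('a \<Rightarrow> 'a \<Rightarrow> 'a) \<Rightarrow> 'a set \<Rightarrow> bool"
  where "leib_subalgebra s b S \<longleftrightarrow> module.subspace s S \<and> (\<forall>x\<in>S. \<forall>y\<in>S. b x y \<in> S)"

definition leib_ideal ::
    "('f::field \<Rightarrow> 'a::ab_group_add \<Rightarrow> 'a) \<Rightarrow> ('a \<Rightarrow> 'a \<Rightarrow> 'a) \<Rightarrow> 'a set \<Rightarrow> bool"
  where "leib_ideal s b I \<longleftrightarrow> module.subspace s I \<and> (\<forall>x. \<forall>i\<in>I. b x i \<in> I \<and> b i x \<in> I)"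

definition gen_subalgebra ::
    "('f::field \<Rightarrow> 'a::ab_group_add \<Rightarrow> 'a) \<Rightarrow> ('a \<Rightarrow> 'a \<Rightarrow> 'a) \<Rightarrow> 'a set \<Rightarrow> 'a set"
  where "gen_subalgebra s b X = leib_subalgebra s b hull X"

definition is_abelian :: "('a::ab_group_add \<Rightarrow> 'a \<Rightarrow> 'a) \<Rightarrow> 'a set \<Rightarrow> bool"
  where "is_abelian b S \<longleftrightarrow> (\<forall>x\<in>S. \<forall>y\<in>S. b x y = 0)"

definition is_cyclic ::
    "('f::field \<Rightarrow> 'a::ab_group_add \<Rightarrow> 'a) \<Rightarrow> ('a \<Rightarrow> 'a \<Rightarrow> 'a) \<Rightarrow> 'a set \<Rightarrow> bool"
  where "is_cyclic s b S \<longleftrightarrow> (\<exists>x\<in>S. S = gen_subalgebra s b {x})"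

definition idealizer :: "('a \<Rightarrow> 'a \<Rightarrow> 'a) \<Rightarrow> 'a set \<Rightarrow> 'a set"
  where "idealizer b S = {x. \<forall>y\<in>S. b x y \<in> S \<and> b y x \<in> S}"

definition self_idealizing :: "('a \<Rightarrow> 'a \<Rightarrow> 'a) \<Rightarrow> 'a set \<Rightarrow> bool"
  where "self_idealizing b S \<longleftrightarrow> S = idealizer b S"

definition leib_center :: "('a::ab_group_add \<Rightarrow> 'a \<Rightarrow> 'a) \<Rightarrow> 'a set \<Rightarrow> 'a set"
  where "leib_center b S = {x\<in>S. \<forall>y\<in>S. b x y = 0 \<and> b y x = 0}"

definition bracket_span ::
    "('f::field \<Rightarrow> 'a::ab_group_add \<Rightarrow> 'a) \<Rightarrow> ('a \<Rightarrow> 'a \<Rightarrow> 'a) \<Rightarrow> 'a set \<Rightarrow> 'a set \<Rightarrow> 'a set"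
  where "bracket_span s b A B = module.span s {b x y |x y. x \<in> A \<and> y \<in> B}"

definition leib_kernel ::
    "('f::field \<Rightarrow> 'a::ab_group_add \<Rightarrow> 'a) \<Rightarrow> ('a \<Rightarrow> 'a \<Rightarrow> 'a) \<Rightarrow> 'a set"
  where "leib_kernel s b = module.span s (range (\<lambda>a. b a a))"

text \<open>
  For left Leibniz algebras the lower central series is formed by bracketing with the
  whole algebra on the left. The index is shifted: \<open>lower_central s b S n\<close> is the term usually
  written with index \<open>n + 1\<close>.
\<close>

primrec lower_central ::
    "('f::field \<Rightarrow> 'a::ab_group_add \<Rightarrow> 'a) \<Rightarrow> ('a \<Rightarrow> 'a \<Rightarrow> 'a) \<Rightarrow> 'a set \<Rightarrow> nat \<Rightarrow> 'a set"
  where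
    "lower_central s b S 0 = S"
  | "lower_central s b S (Suc n) = bracket_span s b S (lower_central s b S n)"

definition leib_nilpotent ::
    "('f::field \<Rightarrow> 'a::ab_group_add \<Rightarrow> 'a) \<Rightarrow> ('a \<Rightarrow> 'a \<Rightarrow> 'a) \<Rightarrow> 'a set \<Rightarrow> bool"
  where "leib_nilpotent s b S \<longleftrightarrow> (\<exists>n. lower_central s b S n = {0})"

definition locally_nilpotent ::
    "('f::field \<Rightarrow> 'a::ab_group_add \<Rightarrow> 'a) \<Rightarrow> ('a \<Rightarrow> 'a \<Rightarrow> 'a) \<Rightarrow> 'a set \<Rightarrow> bool"
  where "locally_nilpotent s b S \<longleftrightarrow>
    (\<forall>X. finite X \<and> X \<subseteq> S \<longrightarrow> leib_nilpotent s b (gen_subalgebra s b X))"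

definition ln_radical ::
    "('f::field \<Rightarrow> 'a::ab_group_add \<Rightarrow> 'a) \<Rightarrow> ('a \<Rightarrow> 'a \<Rightarrow> 'a) \<Rightarrow> 'a set"
  where "ln_radical s b = (GREATEST I. leib_ideal s b I \<and> locally_nilpotent s b I)"

text \<open>
  Elements of the quotient by an ideal \<open>I\<close> are the cosets \<open>x +o I\<close>, its zero is \<open>I\<close> itself, and
  the bracket is defined on cosets in the same way as the product of a factor ring.
\<close>

definition coset_bracket ::
    "('a::ab_group_add \<Rightarrow> 'a \<Rightarrow> 'a) \<Rightarrow> 'a set \<Rightarrow> 'a set \<Rightarrow> 'a set \<Rightarrow> 'a set"
  where "coset_bracket b I X Y = (\<Union>x\<in>X. \<Union>y\<in>Y. b x y +o I)"

definition quotient_abelian :: "('a::ab_group_add \<Rightarrow> 'a \<Rightarrow> 'a) \<Rightarrow> 'a set \<Rightarrow> 'a set \<Rightarrow> bool"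
  where "quotient_abelian b E I \<longleftrightarrow>
    (\<forall>X \<in> (\<lambda>x. x +o I) ` E. \<forall>Y \<in> (\<lambda>x. x +o I) ` E. coset_bracket b I X Y = I)"

definition extraspecial ::
    "('f::field \<Rightarrow> 'a::ab_group_add \<Rightarrow> 'a) \<Rightarrow> ('a \<Rightarrow> 'a \<Rightarrow> 'a) \<Rightarrow> 'a set \<Rightarrow> bool"
  where "extraspecial s b E \<longleftrightarrow>
    leib_subalgebra s b E \<and> vector_space.dim s (leib_center b E) = 1 \<and>
    quotient_abelian b E (leib_center b E)"

definition strong_extraspecial ::
    "('f::field \<Rightarrow> 'a::ab_group_add \<Rightarrow> 'a) \<Rightarrow> ('a \<Rightarrow> 'a \<Rightarrow> 'a) \<Rightarrow> 'a set \<Rightarrow> bool"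
  where "strong_extraspecial s b E \<longleftrightarrow>
    extraspecial s b E \<and> (\<forall>x \<in> E - leib_center b E. b x x \<noteq> 0)"

end

theory Submission
  imports Defs
begin

text \<open>
  A proper subalgebra of a nilpotent algebra is never self-idealizing, so every cyclic subalgebra
  of \<open>K\<close> is an ideal of \<open>L\<close>. This forces \<open>[K, K]\<close> to be a line \<open>Fz\<close>, and it makes each
  element \<open>y\<close> of \<open>L\<close> act on \<open>K / Fz\<close> from the left as a scalar \<open>\<xi>(y)\<close>. If \<open>\<xi>(v) = 0\<close> then \<open>v\<close>
  generates a nilpotent subalgebra, which can only be an ideal, so \<open>v\<close> lies in \<open>K\<close>; hence \<open>K\<close>
  is the kernel of the linear form \<open>\<xi>\<close>. Since \<open>z = [x, x]\<close> is central, the derivation rule gives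
  \<open>2 \<xi> = 0\<close>, so the characteristic is 2. Finally, if \<open>c\<close> in the center of \<open>K\<close> were not a multiple
  of \<open>z\<close>, then both \<open>c\<close> and \<open>c + z\<close> would be eigenvectors of an element \<open>v\<close> with \<open>\<xi>(v) = 1\<close>, although
  \<open>[v, z] = 0\<close>.
\<close>

context left_leibniz_algebra
begin

section \<open>Bilinearity and spans\<close>

lemma bracket_add_left: "b (x + y) z = b x z + b y z"
  and bracket_scale_left: "b (s c x) z = s c (b x z)"
  and bracket_add_right: "b z (x + y) = b z x + b z y"
  and bracket_scale_right: "b z (s c x) = s c (b z x)"
  using linear_left linear_right by (simp_all add: Vector_Spaces.linear_iff)

lemma bracket_zero_left [simp]: "b 0 z = 0"
  and bracket_zero_right [simp]: "b z 0 = 0"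
  using bracket_scale_left[of 0 0] bracket_scale_right[of _ 0 0] by simp_all

lemmas bracket_linear =
  bracket_add_left bracket_scale_left bracket_add_right bracket_scale_right

lemma bracket_diff_left: "b (x - y) z = b x z - b y z"
  by (metis bracket_add_left add_diff_cancel diff_add_cancel)

lemma bracket_span_left_in:
  assumes "x \<in> span A" "subspace T" "\<And>a. a \<in> A \<Longrightarrow> b a y \<in> T"
  shows "b x y \<in> T"
  using assms(1)
  by (rule span_induct_alt)
    (auto simp: bracket_linear subspace_0 subspace_add subspace_scale assms(2,3))

lemma bracket_span_right_in:
  assumes "x \<in> span A" "subspace T" "\<And>a. a \<in> A \<Longrightarrow> b y a \<in> T"
  shows "b y x \<in> T"
  using assms(1)
  by (rule span_induct_alt)
    (auto simp: bracket_linear subspace_0 subspace_add subspace_scale assms(2,3))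

lemma in_span_pair_iff: "x \<in> span {u, w} \<longleftrightarrow> (\<exists>\<alpha> \<beta>. x = s \<alpha> u + s \<beta> w)"
  by (auto simp: span_breakdown_eq span_singleton image_iff diff_eq_eq add.commute)

lemma in_span_single_iff: "x \<in> span {u} \<longleftrightarrow> (\<exists>\<alpha>. x = s \<alpha> u)"
  by (auto simp: span_singleton)

lemma dim_span_single: "u \<noteq> 0 \<Longrightarrow> dim (span {u}) = 1"
  using dim_span_eq_card_independent[of "{u}"] by simp

lemma subspace_set_plus: "subspace I \<Longrightarrow> subspace J \<Longrightarrow> subspace (I + J)"
  using subspace_sums[of I J] by (auto simp: set_plus_def) (smt (verit) Collect_cong)

subsection \<open>Subalgebras and ideals\<close>

lemma ideal_subspace: "leib_ideal s b I \<Longrightarrow> subspace I"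
  and ideal_left: "leib_ideal s b I \<Longrightarrow> i \<in> I \<Longrightarrow> b x i \<in> I"
  and ideal_right: "leib_ideal s b I \<Longrightarrow> i \<in> I \<Longrightarrow> b i x \<in> I"
  by (auto simp: leib_ideal_def)

lemma ideal_imp_subalgebra: "leib_ideal s b I \<Longrightarrow> leib_subalgebra s b I"
  by (auto simp: leib_ideal_def leib_subalgebra_def)

lemma ideal_set_plus:
  assumes "leib_ideal s b I" "leib_ideal s b J"
  shows "leib_ideal s b (I + J)"
  using assms subspace_set_plus[of I J]
  by (auto simp: leib_ideal_def bracket_linear elim!: set_plus_elim intro!: set_plus_intro)

lemma gen_subalgebra_subalgebra: "leib_subalgebra s b (gen_subalgebra s b X)"
  unfolding gen_subalgebra_def
  by (rule hull_in) (auto simp: leib_subalgebra_def intro!: subspace_Inter)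

lemma gen_subalgebra_superset: "X \<subseteq> gen_subalgebra s b X"
  unfolding gen_subalgebra_def by (rule hull_subset)

lemma gen_subalgebra_minimal:
  "X \<subseteq> S \<Longrightarrow> leib_subalgebra s b S \<Longrightarrow> gen_subalgebra s b X \<subseteq> S"
  unfolding gen_subalgebra_def by (rule hull_minimal)

lemma subspace_gen_subalgebra: "subspace (gen_subalgebra s b X)"
  using gen_subalgebra_subalgebra by (simp add: leib_subalgebra_def)

lemma coset_of_element:
  assumes "subspace I" "w \<in> I"
  shows "w +o I = I"
proof
  show "w +o I \<subseteq> I"
    using assms by (auto simp: elt_set_plus_def subspace_add)
  show "I \<subseteq> w +o I"
  proof
    fix x assume "x \<in> I"
    then have "x - w \<in> I" using assms by (simp add: subspace_diff)
    then have "w + (x - w) \<in> w +o I" by blast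
    then show "x \<in> w +o I" by simp
  qed
qed

text \<open>The second assumption is well-definedness of the product modulo \<open>I\<close> at
  \<open>x\<close> and \<open>y\<close>: all cosets in the union then coincide, and the union is
  nonempty because \<open>0\<close> lies in \<open>I\<close>.\<close>

lemma coset_bracket_eq:
  assumes "subspace I"
    and "\<And>i j. i \<in> I \<Longrightarrow> j \<in> I \<Longrightarrow> b (x + i) (y + j) - b x y \<in> I"
  shows "coset_bracket b I (x +o I) (y +o I) = b x y +o I"
proof -
  have "b (x + i) (y + j) +o I = b x y +o I" if "i \<in> I" "j \<in> I" for i j
    using coset_of_element[OF assms(1) assms(2)[OF that]]
    by (metis add.commute diff_add_cancel set_plus_rearrange2)
  moreover have img: "u +o I = (+) u ` I" for u
    by (auto simp: elt_set_plus_def)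
  ultimately have "coset_bracket b I (x +o I) (y +o I) = (\<Union>i\<in>I. \<Union>j\<in>I. b x y +o I)"
    unfolding coset_bracket_def img[of x] img[of y] by simp
  then show ?thesis using subspace_0[OF assms(1)] by auto
qed

subsection \<open>The lower central series\<close>

abbreviation lc :: "'a set \<Rightarrow> nat \<Rightarrow> 'a set"
  where "lc \<equiv> lower_central s b"

lemma bracket_span_subspace: "subspace (bracket_span s b A B)"
  by (simp add: bracket_span_def)

lemma bracket_in_bracket_span: "x \<in> A \<Longrightarrow> y \<in> B \<Longrightarrow> b x y \<in> bracket_span s b A B"
  unfolding bracket_span_def by (rule span_base) blast

lemma bracket_span_minimal:
  "subspace T \<Longrightarrow> (\<And>x y. x \<in> A \<Longrightarrow> y \<in> B \<Longrightarrow> b x y \<in> T) \<Longrightarrow> bracket_span s b A B \<subseteq> T"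
  unfolding bracket_span_def by (rule span_minimal) auto

lemma subspace_lc: "subspace S \<Longrightarrow> subspace (lc S n)"
  by (cases n) (simp_all add: bracket_span_subspace)

lemma lc_mono: "S \<subseteq> T \<Longrightarrow> lc S n \<subseteq> lc T n"
proof (induction n)
  case (Suc n)
  then show ?case
    unfolding lower_central.simps
    by (intro bracket_span_minimal) (auto intro!: bracket_span_subspace bracket_in_bracket_span)
qed simp

lemma lc_Suc_subset: "leib_subalgebra s b S \<Longrightarrow> lc S (Suc n) \<subseteq> lc S n"
proof (induction n)
  case 0
  then show ?case
    unfolding lower_central.simps
    by (intro bracket_span_minimal) (auto simp: leib_subalgebra_def)
next
  case (Suc n)
  show ?case
    using Suc.IH[OF Suc.prems] unfolding lower_central.simps(2)[of s b S "Suc n"]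
    by (intro bracket_span_minimal) (auto intro!: bracket_span_subspace bracket_in_bracket_span)
qed

lemma lc_antimono: "leib_subalgebra s b S \<Longrightarrow> m \<le> n \<Longrightarrow> lc S n \<subseteq> lc S m"
  by (rule lift_Suc_antimono_le[of "lc S"]) (rule lc_Suc_subset)

lemma leib_nilpotentI:
  "subspace S \<Longrightarrow> lc S n \<subseteq> {0} \<Longrightarrow> leib_nilpotent s b S"
  unfolding leib_nilpotent_def using subspace_0[OF subspace_lc] by blast

lemma leib_nilpotent_subset:
  assumes "leib_nilpotent s b T" "S \<subseteq> T" "subspace S"
  shows "leib_nilpotent s b S"
  using assms lc_mono[OF assms(2)] leib_nilpotentI[OF assms(3)]
  unfolding leib_nilpotent_def by metis

text \<open>This is the usual additivity of the series under brackets, with both indices shifted by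
  one. The Leibniz identity trades a left factor \<open>b t w\<close> for successive brackets by
  \<open>t\<close> and \<open>w\<close>.\<close>

lemma bracket_lc:
  assumes "leib_subalgebra s b S"
  shows "x \<in> lc S n \<Longrightarrow> y \<in> lc S m \<Longrightarrow> b x y \<in> lc S (Suc (n + m))"
proof (induction n arbitrary: x y m)
  case 0
  then show ?case by (auto intro: bracket_in_bracket_span)
next
  case (Suc n)
  have sub: "subspace (lc S k)" for k
    using assms by (intro subspace_lc) (simp add: leib_subalgebra_def)
  from Suc.prems(1) have "x \<in> span {b t w |t w. t \<in> S \<and> w \<in> lc S n}"
    by (simp add: bracket_span_def)
  then show ?case
  proof (rule bracket_span_left_in[OF _ sub])
    fix a assume "a \<in> {b t w |t w. t \<in> S \<and> w \<in> lc S n}"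
    then obtain t w where a: "a = b t w" "t \<in> S" "w \<in> lc S n" by blast
    have "b w y \<in> lc S (Suc (n + m))" using Suc a by blast
    then have 1: "b t (b w y) \<in> lc S (Suc (Suc n + m))"
      using a(2) by (auto intro: bracket_in_bracket_span)
    have "b t y \<in> lc S (Suc m)"
      using a(2) Suc.prems(2) by (auto intro: bracket_in_bracket_span)
    \<comment> \<open>The bracket with \<open>t\<close> has raised the level of \<open>y\<close>, so
      the induction hypothesis is used at \<open>Suc m\<close>.\<close>
    then have 2: "b w (b t y) \<in> lc S (Suc (Suc n + m))"
      using Suc.IH[OF a(3)] by fastforce
    show "b a y \<in> lc S (Suc (Suc n + m))"
      using subspace_diff[OF sub 1 2] by (simp add: a(1) leibniz)
  qed
qed

text \<open>As for nilpotent groups: the last term of the series of \<open>T\<close> not contained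
  in \<open>S\<close> has an element outside \<open>S\<close>, and its brackets with
  \<open>S\<close> fall into the next term, hence into \<open>S\<close>.\<close>

lemma nilpotent_not_self_idealizing:
  assumes T: "leib_subalgebra s b T" "leib_nilpotent s b T"
    and S: "leib_subalgebra s b S" "S \<subset> T"
  shows "\<not> self_idealizing b S"
proof
  assume si: "self_idealizing b S"
  have "0 \<in> S" using S(1) by (simp add: leib_subalgebra_def subspace_0)
  then have ex: "\<exists>n. lc T n \<subseteq> S"
    using T(2) by (force simp: leib_nilpotent_def)
  define n where "n = (LEAST n. lc T n \<subseteq> S)"
  have n: "lc T n \<subseteq> S" unfolding n_def using ex by (rule LeastI_ex)
  have "n \<noteq> 0" using n S(2) by auto
  then obtain m where m: "n = Suc m" by (cases n) auto
  have "\<not> lc T m \<subseteq> S"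
    using not_less_Least[of m "\<lambda>n. lc T n \<subseteq> S"] m by (simp add: n_def)
  then obtain w where w: "w \<in> lc T m" "w \<notin> S" by blast
  have "b w t \<in> S \<and> b t w \<in> S" if "t \<in> S" for t
  proof -
    have t: "t \<in> lc T 0" using that S(2) by auto
    show ?thesis
      using bracket_lc[OF T(1) w(1) t] bracket_lc[OF T(1) t w(1)] n m by auto
  qed
  then have "w \<in> idealizer b S" by (auto simp: idealizer_def)
  then show False using si w(2) by (simp add: self_idealizing_def)
qed

subsection \<open>Fitting's theorem\<close>

text \<open>Left multiplication by \<open>x\<close> is a derivation that preserves \<open>I\<close>,
  hence it preserves every term of the series.\<close>

lemma lc_ideal_left:
  assumes "leib_ideal s b I"
  shows "y \<in> lc I n \<Longrightarrow> b x y \<in> lc I n"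
proof (induction n arbitrary: y)
  case 0
  then show ?case using assms by (simp add: ideal_left)
next
  case (Suc n)
  from Suc.prems have "y \<in> span {b t w |t w. t \<in> I \<and> w \<in> lc I n}"
    by (simp add: bracket_span_def)
  then show ?case
  proof (rule bracket_span_right_in)
    show sub: "subspace (lc I (Suc n))" using assms by (intro subspace_lc ideal_subspace)
    fix a assume "a \<in> {b t w |t w. t \<in> I \<and> w \<in> lc I n}"
    then obtain t w where a: "a = b t w" "t \<in> I" "w \<in> lc I n" by blast
    have "b x (b t w) = b (b x t) w + b t (b x w)" by (simp add: leibniz)
    moreover have "b (b x t) w \<in> lc I (Suc n)" "b t (b x w) \<in> lc I (Suc n)"
      using a Suc.IH[OF a(3)] ideal_left[OF assms a(2), of x] by (auto intro!: bracket_in_bracket_span)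
    ultimately show "b x a \<in> lc I (Suc n)"
      using subspace_add[OF sub] a(1) by simp
  qed
qed

text \<open>A right-nested bracket with factors in \<open>I\<close> or \<open>J\<close> moves up one step in the lower central
  series of the ideal from which the new left factor is taken, and stays put in the other one.
  Level 0 is the whole algebra, so that both series start with an ideal at level 1.\<close>

theorem Fitting:
  assumes I: "leib_ideal s b I" "leib_nilpotent s b I"
    and J: "leib_ideal s b J" "leib_nilpotent s b J"
  shows "leib_nilpotent s b (I + J)"
proof -
  define lev where "lev A n = (case n of 0 \<Rightarrow> UNIV | Suc k \<Rightarrow> lc A k)" for A n
  have lev_left: "b x y \<in> lev A n" if "leib_ideal s b A" "y \<in> lev A n" for x y A n
    using that by (auto simp: lev_def lc_ideal_left split: nat.splits)
  have lev_up: "b x y \<in> lev A (Suc n)" if "leib_ideal s b A" "x \<in> A" "y \<in> lev A n" for x y A n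
    using that
    by (auto simp: lev_def ideal_right bracket_in_bracket_span split: nat.splits)
  \<comment> \<open>The index is the total level; each left factor from \<open>I + J\<close> raises
    it by one.\<close>
  define U where "U n = span (\<Union>p\<in>{..n}. lev I p \<inter> lev J (n - p))" for n
  have base: "w \<in> U (p + q)" if "w \<in> lev I p" "w \<in> lev J q" for w p q
    unfolding U_def using that by (intro span_base) (auto intro!: bexI[of _ p])
  have U: "subspace (U n)" for n by (simp add: U_def)
  have main: "lc (I + J) n \<subseteq> U (Suc n)" for n
  proof (induction n)
    case 0
    show ?case
    proof
      fix x assume "x \<in> lc (I + J) 0"
      then obtain i j where x: "x = i + j" "i \<in> I" "j \<in> J" by (auto elim: set_plus_elim)
      have "i \<in> U 1" "j \<in> U 1"
        using base[of i 1 0] base[of j 0 1] x by (auto simp: lev_def)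
      then show "x \<in> U (Suc 0)" using x U by (simp add: subspace_add)
    qed
  next
    case (Suc n)
    have "b x y \<in> U (Suc (Suc n))" if x: "x \<in> I + J" and y: "y \<in> lc (I + J) n" for x y
    proof -
      from x obtain i j where ij: "x = i + j" "i \<in> I" "j \<in> J" by (auto elim: set_plus_elim)
      from y Suc have "y \<in> span (\<Union>p\<in>{..Suc n}. lev I p \<inter> lev J (Suc n - p))"
        by (auto simp: U_def)
      then show ?thesis
      proof (rule bracket_span_right_in[OF _ U])
        fix w assume "w \<in> (\<Union>p\<in>{..Suc n}. lev I p \<inter> lev J (Suc n - p))"
        then obtain p where p: "p \<le> Suc n" "w \<in> lev I p" "w \<in> lev J (Suc n - p)" by auto
        have "b i w \<in> U (Suc p + (Suc n - p))"
          by (intro base lev_up lev_left I J ij p)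
        moreover have "b j w \<in> U (p + Suc (Suc n - p))"
          by (intro base lev_up lev_left I J ij p)
        ultimately show "b x w \<in> U (Suc (Suc n))"
          using p(1) U by (simp add: ij(1) bracket_add_left subspace_add)
      qed
    qed
    then show ?case unfolding lower_central.simps by (intro bracket_span_minimal U)
  qed
  obtain m n where mn: "lc I m = {0}" "lc J n = {0}"
    using I(2) J(2) by (auto simp: leib_nilpotent_def)
  \<comment> \<open>Two levels with sum m + n + 2 cannot be at most m and at most n, so one of the
    two series has already reached 0.\<close>
  have "lev I p \<inter> lev J (Suc (m + n + 1) - p) \<subseteq> {0}" if "p \<le> Suc (m + n + 1)" for p
  proof (cases "Suc m \<le> p")
    case True
    then obtain k where "p = Suc k" "m \<le> k" by (cases p) auto
    then show ?thesis
      using lc_antimono[OF ideal_imp_subalgebra[OF I(1)], of m k] mn by (auto simp: lev_def)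
  next
    case False
    then obtain k where "Suc (m + n + 1) - p = Suc k" "n \<le> k"
      by (cases "Suc (m + n + 1) - p") auto
    then show ?thesis
      using lc_antimono[OF ideal_imp_subalgebra[OF J(1)], of n k] mn by (auto simp: lev_def)
  qed
  then have "U (Suc (m + n + 1)) \<subseteq> {0}"
    unfolding U_def by (intro span_minimal) auto
  then have "lc (I + J) (m + n + 1) \<subseteq> {0}" using main by blast
  then show ?thesis
    by (rule leib_nilpotentI[rotated])
      (intro ideal_subspace ideal_set_plus I J)
qed

subsection \<open>The locally nilpotent radical\<close>

text \<open>By Fitting's theorem the nilpotent ideals form a directed family, which makes their
  union a locally nilpotent ideal.\<close>

lemma finite_subset_nilpotent_ideal:
  assumes "finite X" "X \<subseteq> \<Union>{I. leib_ideal s b I \<and> leib_nilpotent s b I}"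
  shows "\<exists>I. leib_ideal s b I \<and> leib_nilpotent s b I \<and> X \<subseteq> I"
  using assms
proof (induction X rule: finite_induct)
  case empty
  have "leib_ideal s b {0}" by (auto simp: leib_ideal_def subspace_def)
  moreover from this have "leib_nilpotent s b {0}"
    by (intro leib_nilpotentI[of _ 0] ideal_subspace) auto
  ultimately show ?case by blast
next
  case (insert x X)
  obtain I where I: "leib_ideal s b I" "leib_nilpotent s b I" "X \<subseteq> I"
    using insert by auto
  obtain J where J: "leib_ideal s b J" "leib_nilpotent s b J" "x \<in> J"
    using insert.prems by auto
  have "0 \<in> I" "0 \<in> J" using I(1) J(1) by (auto intro: subspace_0 ideal_subspace)
  then have "insert x X \<subseteq> I + J"
    using I(3) J(3) set_plus_intro[of _ I 0 J] set_plus_intro[of 0 I x J] by auto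
  then show ?case using Fitting[OF I(1,2) J(1,2)] ideal_set_plus[OF I(1) J(1)] by blast
qed

text \<open>The dichotomy for subalgebras makes every cyclic subalgebra of a locally nilpotent ideal
  an ideal, so that the radical is the union of all nilpotent ideals.\<close>

theorem ln_radical_eq:
  assumes hyp: "\<forall>S. leib_subalgebra s b S \<longrightarrow> leib_ideal s b S \<or> self_idealizing b S"
  shows "ln_radical s b = \<Union>{I. leib_ideal s b I \<and> leib_nilpotent s b I}" (is "_ = ?U")
    and "leib_ideal s b (ln_radical s b)"
proof -
  have ideal: "leib_ideal s b ?U"
  proof -
    have "0 \<in> ?U"
      using finite_subset_nilpotent_ideal[of "{}"] by (auto intro: subspace_0 ideal_subspace)
    moreover have "x + y \<in> ?U" if "x \<in> ?U" "y \<in> ?U" for x y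
    proof -
      obtain I where "leib_ideal s b I" "leib_nilpotent s b I" "x \<in> I" "y \<in> I"
        using finite_subset_nilpotent_ideal[of "{x, y}"] \<open>x \<in> ?U\<close> \<open>y \<in> ?U\<close> by auto
      then show ?thesis by (auto intro: subspace_add ideal_subspace)
    qed
    moreover have "s c x \<in> ?U \<and> b y x \<in> ?U \<and> b x y \<in> ?U" if "x \<in> ?U" for c x y
    proof -
      obtain I where "leib_ideal s b I" "leib_nilpotent s b I" "x \<in> I"
        using \<open>x \<in> ?U\<close> by auto
      then show ?thesis
        by (auto intro: subspace_scale ideal_subspace ideal_left ideal_right)
    qed
    ultimately show ?thesis
      unfolding leib_ideal_def[of s b ?U]
      by (intro conjI allI ballI subspaceI) (simp_all only:)
  qed
  have nil: "locally_nilpotent s b ?U"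
    unfolding locally_nilpotent_def
  proof (intro allI impI)
    fix X assume "finite X \<and> X \<subseteq> ?U"
    then obtain I where "leib_ideal s b I" "leib_nilpotent s b I" "X \<subseteq> I"
      using finite_subset_nilpotent_ideal[of X] by auto
    then show "leib_nilpotent s b (gen_subalgebra s b X)"
      by (meson leib_nilpotent_subset gen_subalgebra_minimal ideal_imp_subalgebra
          subspace_gen_subalgebra)
  qed
  have greatest: "A \<subseteq> ?U" if A: "leib_ideal s b A" "locally_nilpotent s b A" for A
  proof
    fix x assume x: "x \<in> A"
    let ?C = "gen_subalgebra s b {x}"
    have CA: "?C \<subseteq> A" using x A(1) by (simp add: gen_subalgebra_minimal ideal_imp_subalgebra)
    have nilC: "leib_nilpotent s b ?C" using x A(2) by (simp add: locally_nilpotent_def)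
    have "leib_ideal s b ?C"
    proof (cases "?C = A")
      case False
      then obtain y where y: "y \<in> A" "y \<notin> ?C" using CA by blast
      \<comment> \<open>\<open>A\<close> is only locally nilpotent, so \<open>?C\<close> is compared
        with a finitely generated subalgebra of \<open>A\<close> in which it is proper.\<close>
      let ?T = "gen_subalgebra s b {x, y}"
      have "leib_nilpotent s b ?T" using x y A(2) by (simp add: locally_nilpotent_def)
      moreover have "?C \<subset> ?T"
        using y(2) gen_subalgebra_superset[of "{x, y}"]
          gen_subalgebra_minimal[OF _ gen_subalgebra_subalgebra, of "{x}" "{x, y}"] by auto
      ultimately show ?thesis
        using hyp nilpotent_not_self_idealizing gen_subalgebra_subalgebra by blast
    qed (use A in simp)
    then show "x \<in> ?U" using nilC gen_subalgebra_superset[of "{x}"] by auto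
  qed
  show eq: "ln_radical s b = ?U"
    unfolding ln_radical_def using ideal nil greatest by (intro Greatest_equality) auto
  show "leib_ideal s b (ln_radical s b)" unfolding eq by (rule ideal)
qed

subsection \<open>The Leibniz kernel\<close>

text \<open>When its first two arguments agree, the right-hand side of the Leibniz identity cancels,
  so squares annihilate from the left.\<close>

lemma bracket_kernel_left: "l \<in> leib_kernel s b \<Longrightarrow> b l x = 0"
  using bracket_span_left_in[of l "range (\<lambda>a. b a a)" "{0}" x] subspace_single_0
  by (fastforce simp: leib_kernel_def leibniz)

lemma square_in_kernel: "b x x \<in> leib_kernel s b"
  unfolding leib_kernel_def by (rule span_base) simp

lemma subspace_kernel: "subspace (leib_kernel s b)"
  by (simp add: leib_kernel_def)

lemma symmetric_bracket_in_kernel: "b x y + b y x \<in> leib_kernel s b"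
proof -
  have "b x y + b y x = b (x + y) (x + y) - b x x - b y y"
    by (simp add: bracket_linear algebra_simps)
  then show ?thesis using square_in_kernel subspace_kernel subspace_diff by presburger
qed

text \<open>Since \<open>b l x = 0\<close>, the bracket \<open>b x l\<close> equals the polarized
  square \<open>b x l + b l x\<close>.\<close>

lemma kernel_ideal: "leib_ideal s b (leib_kernel s b)"
proof -
  have "b x l \<in> leib_kernel s b" if "l \<in> leib_kernel s b" for x l
    using symmetric_bracket_in_kernel[of x l] bracket_kernel_left[OF that, of x] by simp
  then show ?thesis
    using bracket_kernel_left subspace_kernel by (auto simp: leib_ideal_def subspace_0)
qed

lemma kernel_nilpotent: "leib_nilpotent s b (leib_kernel s b)"
proof (rule leib_nilpotentI[OF subspace_kernel])
  show "lc (leib_kernel s b) 1 \<subseteq> {0}"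
    using bracket_span_minimal[OF subspace_single_0] by (simp add: bracket_kernel_left)
qed

end


subsection \<open>Locally nilpotent radicals with central derived subalgebra\<close>

text \<open>The radical enters as an ideal that contains every nilpotent ideal;
  \<open>ln_radical_eq\<close> supplies both properties.\<close>

locale central_derived_radical = left_leibniz_algebra s b
  for s :: "'f::field \<Rightarrow> 'a::ab_group_add \<Rightarrow> 'a" and b +
  fixes K :: "'a set"
  assumes dichotomy: "leib_subalgebra s b S \<Longrightarrow> leib_ideal s b S \<or> self_idealizing b S"
    and K_ideal: "leib_ideal s b K"
    and nilpotent_ideal_le: "leib_ideal s b I \<Longrightarrow> leib_nilpotent s b I \<Longrightarrow> I \<subseteq> K"
    and not_cyclic: "\<not> is_cyclic s b K"
    and not_abelian: "\<not> is_abelian b K"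
    and derived_central: "bracket_span s b K K \<subseteq> leib_center b UNIV"
begin

lemma K_subspace: "subspace K"
  using K_ideal by (rule ideal_subspace)

lemma bracket_K_central:
  assumes "x \<in> K" "y \<in> K"
  shows "b (b x y) w = 0" "b w (b x y) = 0"
  using derived_central bracket_in_bracket_span[OF assms] by (auto simp: leib_center_def)

lemma kernel_le_K: "leib_kernel s b \<subseteq> K"
  using kernel_ideal kernel_nilpotent by (rule nilpotent_ideal_le)

lemma self_idealizing_contains_central:
  assumes "leib_subalgebra s b S" "self_idealizing b S" "\<And>w. b c w = 0" "\<And>w. b w c = 0"
  shows "c \<in> S"
  using assms by (auto simp: self_idealizing_def idealizer_def leib_subalgebra_def subspace_0)

text \<open>The square annihilates from the left, so by the assumption \<open>b x x\<close> is the
  only product of the two spanning vectors that can survive.\<close>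

lemma subalgebra_square:
  assumes "b x (b x x) = 0"
  shows "leib_subalgebra s b (span {x, b x x})"
proof -
  have "b u w \<in> span {x, b x x}" if "u \<in> span {x, b x x}" "w \<in> span {x, b x x}" for u w
  proof -
    from that obtain \<alpha> \<beta> \<gamma> \<delta> where
      "u = s \<alpha> x + s \<beta> (b x x)" "w = s \<gamma> x + s \<delta> (b x x)"
      unfolding in_span_pair_iff by blast
    then have "b u w = s 0 x + s (\<alpha> * \<gamma>) (b x x)"
      using assms bracket_kernel_left[OF square_in_kernel] by (simp add: bracket_linear mult.commute)
    then show ?thesis unfolding in_span_pair_iff by blast
  qed
  then show ?thesis by (simp add: leib_subalgebra_def)
qed

text \<open>Otherwise the span is self-idealizing and contains the central subspace [K, K]. Then all
  of \<open>K\<close> idealizes it, so \<open>K\<close> equals it and is cyclic.\<close>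

lemma K_cyclic_ideal:
  assumes "x \<in> K"
  shows "leib_ideal s b (span {x, b x x})" (is "leib_ideal s b ?S")
proof (rule ccontr)
  assume "\<not> leib_ideal s b ?S"
  moreover have S: "leib_subalgebra s b ?S"
    using assms by (intro subalgebra_square bracket_K_central)
  ultimately have si: "self_idealizing b ?S" using dichotomy by blast
  have SK: "?S \<subseteq> K"
    using assms K_ideal by (intro span_minimal K_subspace) (auto intro: ideal_left)
  have derived: "b u w \<in> ?S" if "u \<in> K" "w \<in> K" for u w
    using self_idealizing_contains_central[OF S si] bracket_K_central[OF that] by blast
  have "K \<subseteq> idealizer b ?S"
    using SK derived by (auto simp: idealizer_def)
  then have "K = ?S" using SK si by (auto simp: self_idealizing_def)
  moreover have "?S = gen_subalgebra s b {x}"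
  proof
    show "gen_subalgebra s b {x} \<subseteq> ?S"
      by (intro gen_subalgebra_minimal S) (auto intro: span_base)
    have "x \<in> gen_subalgebra s b {x}" using gen_subalgebra_superset[of "{x}"] by simp
    then show "?S \<subseteq> gen_subalgebra s b {x}"
      using gen_subalgebra_subalgebra[of "{x}"]
      by (intro span_minimal subspace_gen_subalgebra) (auto simp: leib_subalgebra_def)
  qed
  ultimately show False using not_cyclic assms by (auto simp: is_cyclic_def)
qed

section \<open>Brackets inside K\<close>

lemma K_bracket_forms:
  assumes "x \<in> K"
  shows "\<exists>\<alpha> \<beta>. b y x = s \<alpha> x + s \<beta> (b x x)" "\<exists>\<alpha> \<beta>. b x y = s \<alpha> x + s \<beta> (b x x)"
proof -
  have "x \<in> span {x, b x x}" by (simp add: span_base)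
  then show "\<exists>\<alpha> \<beta>. b y x = s \<alpha> x + s \<beta> (b x x)" "\<exists>\<alpha> \<beta>. b x y = s \<alpha> x + s \<beta> (b x x)"
    using K_cyclic_ideal[OF assms] unfolding in_span_pair_iff[symmetric]
    by (blast intro: ideal_left ideal_right)+
qed

text \<open>A nonzero coefficient at \<open>x\<close> would make \<open>x\<close> a combination of
  central elements; then both brackets of \<open>x\<close> and \<open>y\<close> vanish
  anyway.\<close>

lemma K_bracket_multiple_square:
  assumes x: "x \<in> K" and y: "y \<in> K"
  shows "\<exists>\<beta>. b y x = s \<beta> (b x x)" "\<exists>\<beta>. b x y = s \<beta> (b x x)"
proof -
  have *: "\<exists>\<beta>. w = s \<beta> (b x x)"
    if w: "w = s \<alpha> x + s \<beta> (b x x)" "w = b y x \<or> w = b x y" for w \<alpha> \<beta>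
  proof (cases "\<alpha> = 0")
    case False
    have "s \<alpha> x = w - s \<beta> (b x x)" using w(1) by simp
    moreover have "b w y = 0" "b y w = 0"
      using w(2) bracket_K_central[OF x y] bracket_K_central[OF y x] by auto
    moreover have "b (w - s \<beta> (b x x)) y = b w y - s \<beta> (b (b x x) y)"
      by (simp add: bracket_diff_left bracket_linear)
    moreover have "b y w = s \<alpha> (b y x) + s \<beta> (b y (b x x))"
      unfolding w(1) by (simp add: bracket_linear)
    ultimately have "s \<alpha> (b x y) = 0" "s \<alpha> (b y x) = 0"
      using bracket_K_central[OF x x] bracket_scale_left[of \<alpha> x y] by simp_all
    then have "w = s 0 (b x x)" using w(2) False by auto
    then show ?thesis by blast
  qed (use w in auto)
  show "\<exists>\<beta>. b y x = s \<beta> (b x x)" "\<exists>\<beta>. b x y = s \<beta> (b x x)"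
    using K_bracket_forms[OF x, of y] * by blast+
qed

lemma K_square_zero_center:
  assumes "x \<in> K" "b x x = 0" "y \<in> K"
  shows "b x y = 0" "b y x = 0"
  using K_bracket_multiple_square[OF assms(1,3)] assms(2) by auto

lemma nonzero_square: "\<exists>x\<in>K. b x x \<noteq> 0"
  using not_abelian K_square_zero_center(1) unfolding is_abelian_def by blast

text \<open>A nonzero bracket of \<open>x\<close> and \<open>y\<close> is a multiple of both
  squares. If both brackets vanish, then \<open>b x (x + y) = b x x\<close> is a multiple of the
  square of \<open>x + y\<close>, which is the sum of the two squares.\<close>

lemma square_proportional:
  assumes x: "x \<in> K" "b x x \<noteq> 0" and y: "y \<in> K"
  shows "\<exists>\<gamma>. b y y = s \<gamma> (b x x)"
proof (cases "b x y = 0 \<and> b y x = 0")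
  case True
  let ?w = "x + y"
  have w: "?w \<in> K" using x(1) y K_subspace by (simp add: subspace_add)
  have "b x ?w = b x x" using True by (simp add: bracket_linear)
  moreover have sq: "b ?w ?w = b x x + b y y" using True by (simp add: bracket_linear)
  ultimately obtain \<gamma> where \<gamma>: "b x x = s \<gamma> (b x x + b y y)"
    using K_bracket_multiple_square(1)[OF w x(1)] by metis
  then have "\<gamma> \<noteq> 0" using x(2) by auto
  then have "b x x + b y y = s (1 / \<gamma>) (b x x)"
    using arg_cong[OF \<gamma>, of "s (1 / \<gamma>)"] by simp
  then have "b y y = s (1 / \<gamma> - 1) (b x x)"
    by (simp add: scale_left_diff_distrib algebra_simps)
  then show ?thesis by blast
next
  case False
  then obtain w where w: "w \<noteq> 0" "w = b x y \<or> w = b y x" by auto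
  obtain \<alpha> where \<alpha>: "w = s \<alpha> (b x x)"
    using K_bracket_multiple_square[OF x(1) y] w(2) by blast
  obtain \<beta> where \<beta>: "w = s \<beta> (b y y)"
    using K_bracket_multiple_square[OF y x(1)] w(2) by blast
  have "\<beta> \<noteq> 0" using w \<beta> by auto
  then have "b y y = s (1 / \<beta>) w" using \<beta> by simp
  then show ?thesis using \<alpha> by auto
qed

text \<open>Such an element exists by \<open>nonzero_square\<close>. Its square will span [K, K],
  and its image under left multiplication by \<open>y\<close> reveals the scalar by which
  \<open>y\<close> acts.\<close>

definition x0 :: 'a where "x0 = (SOME x. x \<in> K \<and> b x x \<noteq> 0)"

definition z :: 'a where "z = b x0 x0"

lemma x0_in_K: "x0 \<in> K" and z_nonzero: "z \<noteq> 0"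
proof -
  have "x0 \<in> K \<and> b x0 x0 \<noteq> 0"
    unfolding x0_def using someI_ex[of "\<lambda>x. x \<in> K \<and> b x x \<noteq> 0"] nonzero_square by blast
  then show "x0 \<in> K" "z \<noteq> 0" by (auto simp: z_def)
qed

lemma z_in_K: "z \<in> K"
  unfolding z_def using K_ideal x0_in_K by (rule ideal_left)

lemma z_central [simp]: "b z w = 0" "b w z = 0"
  unfolding z_def using bracket_K_central[OF x0_in_K x0_in_K] by auto

lemma z_in_kernel: "z \<in> leib_kernel s b"
  unfolding z_def by (rule square_in_kernel)

lemma x0_not_multiple_z: "x0 \<noteq> s \<alpha> z"
proof
  assume "x0 = s \<alpha> z"
  then have "b x0 x0 = s \<alpha> (b z x0)" by (metis bracket_scale_left)
  then show False using z_nonzero by (simp flip: z_def)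
qed

lemma K_bracket_multiple_z:
  assumes "x \<in> K" "y \<in> K"
  shows "\<exists>\<beta>. b x y = s \<beta> z"
proof -
  obtain \<alpha> where "b x y = s \<alpha> (b x x)"
    using K_bracket_multiple_square(2)[OF assms] by blast
  moreover obtain \<gamma> where "b x x = s \<gamma> z"
    using square_proportional[OF x0_in_K _ assms(1)] z_nonzero unfolding z_def by blast
  ultimately show ?thesis by auto
qed

section \<open>The scalar action of L on K / Fz\<close>

lemma bracket_into_K:
  assumes "x \<in> K"
  shows "\<exists>\<alpha> \<beta>. b y x = s \<alpha> x + s \<beta> z"
proof -
  obtain \<alpha> \<beta> where "b y x = s \<alpha> x + s \<beta> (b x x)"
    using K_bracket_forms(1)[OF assms] by blast
  moreover obtain \<gamma> where "b x x = s \<gamma> z" using K_bracket_multiple_z[OF assms assms] by blast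
  ultimately show ?thesis by (metis scale_scale)
qed

lemma bracket_square_zero:
  assumes "x \<in> K" "b x x = 0"
  shows "\<exists>\<alpha>. b y x = s \<alpha> x"
  using K_bracket_forms(1)[OF assms(1), of y] assms(2) by auto

text \<open>Every cyclic subalgebra of \<open>K\<close> being an ideal, left multiplication by \<open>y\<close> acts on
  \<open>K / Fz\<close> with every vector as an eigenvector, hence as a scalar.\<close>

lemma bracket_into_K_scalar:
  assumes y: "b y x0 = s \<xi> x0 + s \<beta> z" and x: "x \<in> K"
  shows "\<exists>\<beta>. b y x = s \<xi> x + s \<beta> z"
proof (cases "x \<in> span {x0, z}")
  case True
  then obtain \<gamma> \<delta> where "x = s \<gamma> x0 + s \<delta> z" by (auto simp: in_span_pair_iff)
  then have "b y x = s \<xi> x + s (\<gamma> * \<beta> - \<xi> * \<delta>) z"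
    by (simp add: bracket_linear y algebra_simps)
  then show ?thesis by blast
next
  case False
  obtain \<alpha> \<beta>' where 1: "b y x = s \<alpha> x + s \<beta>' z" using bracket_into_K[OF x] by blast
  have "x + x0 \<in> K" using x x0_in_K K_subspace by (simp add: subspace_add)
  then obtain \<rho> \<mu> where 2: "b y (x + x0) = s \<rho> (x + x0) + s \<mu> z"
    using bracket_into_K by blast
  \<comment> \<open>The eigenvalues at \<open>x\<close>, \<open>x0\<close> and \<open>x + x0\<close>
    are compared; \<open>x\<close> and \<open>x0\<close> are independent modulo Fz, so they all
    agree.\<close>
  have eq: "s (\<alpha> - \<rho>) x = s (\<rho> - \<xi>) x0 + s (\<mu> - \<beta> - \<beta>') z"
    using 1 2 y by (simp add: bracket_linear algebra_simps)
  have "\<alpha> = \<rho>"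
  proof (rule ccontr)
    assume "\<alpha> \<noteq> \<rho>"
    then have "x = s (1 / (\<alpha> - \<rho>)) (s (\<alpha> - \<rho>) x)" by simp
    then have "x = s ((\<rho> - \<xi>) / (\<alpha> - \<rho>)) x0 + s ((\<mu> - \<beta> - \<beta>') / (\<alpha> - \<rho>)) z"
      unfolding eq by (simp add: scale_right_distrib)
    then show False using False in_span_pair_iff by blast
  qed
  moreover have "\<rho> = \<xi>"
  proof (rule ccontr)
    assume "\<rho> \<noteq> \<xi>"
    have "s (\<rho> - \<xi>) x0 = s (\<beta> + \<beta>' - \<mu>) z"
      using eq \<open>\<alpha> = \<rho>\<close> by (simp add: algebra_simps)
    then have "s (1 / (\<rho> - \<xi>)) (s (\<rho> - \<xi>) x0) = s ((\<beta> + \<beta>' - \<mu>) / (\<rho> - \<xi>)) z"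
      by simp
    then show False using \<open>\<rho> \<noteq> \<xi>\<close> x0_not_multiple_z by simp
  qed
  ultimately show ?thesis using 1 by blast
qed

text \<open>Here \<open>c\<close> spans an ideal by itself, so it is an exact eigenvector and not
  just one modulo Fz; as \<open>c\<close> lies outside Fz, the two eigenvalues agree.\<close>

lemma square_zero_eigen:
  assumes y: "b y x0 = s \<xi> x0 + s \<beta> z" and c: "c \<in> K" "b c c = 0" "c \<notin> span {z}"
  shows "b y c = s \<xi> c"
proof -
  obtain \<alpha> where \<alpha>: "b y c = s \<alpha> c" using bracket_square_zero c by blast
  obtain \<beta> where \<beta>: "b y c = s \<xi> c + s \<beta> z" using bracket_into_K_scalar[OF y c(1)] by blast
  have "s (\<alpha> - \<xi>) c = s \<beta> z" using \<alpha> \<beta> by (simp add: algebra_simps)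
  \<comment> \<open>For equal scalars both sides are 0, as division by zero yields 0.\<close>
  then have "s (1 / (\<alpha> - \<xi>)) (s (\<alpha> - \<xi>) c) = s (\<beta> / (\<alpha> - \<xi>)) z" by simp
  then have "\<alpha> \<noteq> \<xi> \<Longrightarrow> c = s (\<beta> / (\<alpha> - \<xi>)) z" by simp
  then have "\<alpha> = \<xi>" using c(3) in_span_single_iff by blast
  then show ?thesis using \<alpha> by simp
qed

text \<open>If \<open>v\<close> acts on \<open>K / Fz\<close> as 0, then the cyclic subalgebra of \<open>v\<close> is nilpotent. Were it
  self-idealizing, it would contain \<open>z\<close>, then the Leibniz kernel, and then \<open>K\<close>.\<close>

lemma zero_action_in_K:
  assumes v: "b v x0 = s \<beta> z"
  shows "v \<in> K"
proof (rule ccontr)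
  assume vK: "v \<notin> K"
  have v': "b v x0 = s 0 x0 + s \<beta> z" using v by simp
  let ?q = "b v v" and ?T = "span {v, b v v}"
  \<comment> \<open>Elements of the kernel have square zero: those outside Fz are eigenvectors of
    \<open>v\<close> for the eigenvalue 0, and those in Fz are central.\<close>
  have v_kernel: "b v l = 0" if "l \<in> leib_kernel s b" for l
  proof (cases "l \<in> span {z}")
    case True
    then show ?thesis by (auto simp: in_span_single_iff bracket_linear)
  next
    case False
    moreover have "l \<in> K" using that kernel_le_K by blast
    ultimately show ?thesis
      using square_zero_eigen[OF v', of l] bracket_kernel_left[OF that] by simp
  qed
  have q: "?q \<in> leib_kernel s b" by (rule square_in_kernel)
  note q0 = bracket_kernel_left[OF q] v_kernel[OF q]
  have T: "leib_subalgebra s b ?T" using q0 by (intro subalgebra_square)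
  have T_K: "\<exists>\<gamma>. t = s \<gamma> ?q" if t': "t \<in> ?T" "t \<in> K" for t
  proof -
    obtain \<alpha> \<gamma> where t: "t = s \<alpha> v + s \<gamma> ?q" using t'(1) in_span_pair_iff by blast
    have "s \<alpha> v \<in> K"
    proof -
      have "s \<alpha> v = t - s \<gamma> ?q" using t by simp
      moreover have "s \<gamma> ?q \<in> K" using q kernel_le_K by (intro subspace_scale K_subspace) blast
      ultimately show ?thesis using t'(2) K_subspace by (simp add: subspace_diff)
    qed
    then have "\<alpha> = 0"
      using vK subspace_scale[OF K_subspace, of "s \<alpha> v" "1 / \<alpha>"] by (cases "\<alpha> = 0") auto
    then show ?thesis using t by auto
  qed
  have "leib_nilpotent s b ?T"
  proof (rule leib_nilpotentI)
    have "lc ?T 1 \<subseteq> span {?q}"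
      unfolding One_nat_def lower_central.simps
    proof (rule bracket_span_minimal)
      fix x y assume "x \<in> ?T" "y \<in> ?T"
      then obtain \<alpha> \<beta> \<gamma> \<delta> where "x = s \<alpha> v + s \<beta> ?q" "y = s \<gamma> v + s \<delta> ?q"
        by (auto simp: in_span_pair_iff)
      then have "b x y = s (\<alpha> * \<gamma>) ?q" by (simp add: bracket_linear q0 mult.commute)
      then show "b x y \<in> span {?q}" using in_span_single_iff by blast
    qed simp
    moreover have "b x y = 0" if "x \<in> ?T" "y \<in> span {?q}" for x y
      using that by (auto simp: in_span_single_iff in_span_pair_iff bracket_linear q0)
    ultimately show "lc ?T (Suc 1) \<subseteq> {0}"
      unfolding lower_central.simps(2)[of s b ?T 1]
      by (intro bracket_span_minimal subspace_single_0) blast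
  qed simp
  moreover have "v \<in> ?T" by (simp add: span_base)
  ultimately have "\<not> leib_ideal s b ?T" using nilpotent_ideal_le vK by blast
  then have si: "self_idealizing b ?T" using dichotomy T by blast
  \<comment> \<open>The remaining bracket \<open>b ?q x\<close> is zero because \<open>?q\<close>
    lies in the Leibniz kernel.\<close>
  have into_T: "x \<in> ?T" if "b v x \<in> ?T" "b x v \<in> ?T" "b x ?q \<in> ?T" for x
  proof -
    have "b x t \<in> ?T \<and> b t x \<in> ?T" if "t \<in> ?T" for t
      using that \<open>b v x \<in> ?T\<close> \<open>b x v \<in> ?T\<close> \<open>b x ?q \<in> ?T\<close>
      by (auto simp: in_span_pair_iff[of t] bracket_linear q0 intro!: span_add span_scale)
    then show ?thesis using si by (auto simp: self_idealizing_def idealizer_def)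
  qed
  have zT: "z \<in> ?T" by (rule self_idealizing_contains_central[OF T si]) simp_all
  then obtain \<gamma> where \<gamma>: "z = s \<gamma> ?q" using T_K z_in_K by blast
  then have "\<gamma> \<noteq> 0" using z_nonzero by auto
  then have q_z: "?q = s (1 / \<gamma>) z" using \<gamma> by simp
  have multiple_T: "s \<alpha> z \<in> ?T" for \<alpha> using zT by (rule span_scale)
  have kernel_z: "\<exists>\<alpha>. l = s \<alpha> z" if l: "l \<in> leib_kernel s b" for l
  proof -
    have "l \<in> ?T"
      by (rule into_T) (simp_all add: bracket_kernel_left[OF l] v_kernel[OF l] span_zero)
    then obtain \<delta> where "l = s \<delta> ?q" using T_K l kernel_le_K by blast
    then show ?thesis using q_z by auto
  qed
  have "x0 \<in> ?T"
  proof (rule into_T)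
    show "b v x0 \<in> ?T" using v multiple_T by simp
    \<comment> \<open>The bracket is antisymmetric modulo the Leibniz kernel, which by now is
      contained in Fz.\<close>
    obtain \<alpha> where "b x0 v + b v x0 = s \<alpha> z"
      using kernel_z symmetric_bracket_in_kernel by blast
    then have "b x0 v = s (\<alpha> - \<beta>) z" using v by (simp add: algebra_simps)
    then show "b x0 v \<in> ?T" using multiple_T by simp
    show "b x0 ?q \<in> ?T" by (simp add: q_z bracket_linear span_zero)
  qed
  then obtain \<delta> where "x0 = s \<delta> ?q" using T_K x0_in_K by blast
  then show False using q_z x0_not_multiple_z by simp
qed

end

section \<open>Proper radicals: characteristic, centers and squares\<close>

locale proper_central_derived_radical = central_derived_radical s b K
  for s :: "'f::field \<Rightarrow> 'a::ab_group_add \<Rightarrow> 'a" and b K +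
  assumes K_proper: "K \<noteq> UNIV"
begin

text \<open>An element outside \<open>K\<close> acts by a nonzero scalar, by
  \<open>zero_action_in_K\<close>, and can be rescaled.\<close>

lemma exists_unit_action: "\<exists>v \<beta>. b v x0 = x0 + s \<beta> z"
proof -
  obtain v where v: "v \<notin> K" using K_proper by blast
  obtain \<xi> \<beta> where \<xi>: "b v x0 = s \<xi> x0 + s \<beta> z" using bracket_into_K[OF x0_in_K] by blast
  then have "\<xi> \<noteq> 0" using zero_action_in_K[of v \<beta>] v by auto
  then have "b (s (1 / \<xi>) v) x0 = x0 + s (\<beta> / \<xi>) z"
    by (simp add: bracket_linear \<xi> algebra_simps)
  then show ?thesis by blast
qed

definition v :: 'a where "v = (SOME v. \<exists>\<beta>. b v x0 = x0 + s \<beta> z)"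

text \<open>The explicit factor 1 gives the shape that \<open>bracket_into_K_scalar\<close> and
  \<open>square_zero_eigen\<close> expect.\<close>

lemma v_x0: "\<exists>\<beta>. b v x0 = s 1 x0 + s \<beta> z"
  unfolding v_def using someI_ex[OF exists_unit_action] by simp

lemma v_acts: "x \<in> K \<Longrightarrow> \<exists>\<beta>. b v x = x + s \<beta> z"
  using v_x0 bracket_into_K_scalar by fastforce

lemma v_notin_K: "v \<notin> K"
proof
  assume "v \<in> K"
  then obtain \<alpha> where "b v x0 = s \<alpha> z" using K_bracket_multiple_z x0_in_K by blast
  moreover obtain \<beta> where "b v x0 = s 1 x0 + s \<beta> z" using v_x0 by blast
  ultimately have "x0 = s (\<alpha> - \<beta>) z" by (simp add: algebra_simps)
  then show False using x0_not_multiple_z by blast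
qed

lemma two_eq_zero: "(2 :: 'f) = 0"
proof -
  obtain \<beta> where \<beta>: "b v x0 = x0 + s \<beta> z" using v_acts[OF x0_in_K] by blast
  have "0 = b v (b x0 x0)" by (simp flip: z_def)
  also have "\<dots> = b (b v x0) x0 + b x0 (b v x0)" by (simp add: leibniz)
  also have "\<dots> = z + z" by (simp add: \<beta> bracket_linear flip: z_def)
  also have "\<dots> = s 2 z" by (metis one_add_one scale_left_distrib scale_one)
  finally show ?thesis using z_nonzero by simp
qed

text \<open>Otherwise \<open>c\<close> and \<open>c + z\<close> are both fixed by left
  multiplication by \<open>v\<close>, and so is their difference \<open>z\<close>, which is central
  and nonzero.\<close>

lemma square_zero_multiple_z:
  assumes c: "c \<in> K" "b c c = 0"
  shows "c \<in> span {z}"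
proof (rule ccontr)
  assume cz: "c \<notin> span {z}"
  obtain \<beta> where \<beta>: "b v x0 = s 1 x0 + s \<beta> z" using v_x0 by blast
  have "c + z \<in> K" using c z_in_K K_subspace by (simp add: subspace_add)
  moreover have "b (c + z) (c + z) = 0" using c by (simp add: bracket_linear)
  moreover have "c + z \<notin> span {z}" using cz by (metis insertI1 span_add_eq2 span_base)
  ultimately have "b v (c + z) = c + z" using square_zero_eigen[OF \<beta>] by simp
  moreover have "b v c = c" using square_zero_eigen[OF \<beta>] c cz by simp
  ultimately show False using z_nonzero by (simp add: bracket_linear)
qed

lemma multiple_z_in_K: "span {z} \<subseteq> K"
  using z_in_K by (intro span_minimal K_subspace) simp

lemma center_K: "leib_center b K = span {z}"
proof
  show "leib_center b K \<subseteq> span {z}"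
    using square_zero_multiple_z by (auto simp: leib_center_def)
  show "span {z} \<subseteq> leib_center b K"
    using multiple_z_in_K by (auto simp: leib_center_def in_span_single_iff bracket_linear)
qed

lemma center_UNIV: "leib_center b UNIV = span {z}"
proof
  show "leib_center b UNIV \<subseteq> span {z}"
  proof
    fix c assume c: "c \<in> leib_center b UNIV"
    \<comment> \<open>A central element acts by the scalar 0, which places it in
      \<open>K\<close>.\<close>
    then have "b c x0 = s 0 z" by (simp add: leib_center_def)
    then have "c \<in> K" by (rule zero_action_in_K)
    then show "c \<in> span {z}" using c square_zero_multiple_z by (simp add: leib_center_def)
  qed
  show "span {z} \<subseteq> leib_center b UNIV"
    by (auto simp: leib_center_def in_span_single_iff bracket_linear)
qed

lemma kernel_eq: "leib_kernel s b = span {z}"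
proof
  show "leib_kernel s b \<subseteq> span {z}"
    using square_zero_multiple_z kernel_le_K bracket_kernel_left by blast
  show "span {z} \<subseteq> leib_kernel s b"
    using z_in_kernel by (intro span_minimal subspace_kernel) simp
qed

lemma derived_K: "bracket_span s b K K = span {z}"
proof
  show "bracket_span s b K K \<subseteq> span {z}"
    using K_bracket_multiple_z by (intro bracket_span_minimal) (auto simp: in_span_single_iff)
  show "span {z} \<subseteq> bracket_span s b K K"
    using bracket_in_bracket_span[OF x0_in_K x0_in_K]
    by (intro span_minimal bracket_span_subspace) (simp flip: z_def)
qed

text \<open>An element of square zero outside Fz spans an abelian subalgebra that misses the central
  \<open>z\<close>. So this is not self-idealizing but a nilpotent ideal, and lies in
  \<open>K\<close>, where only multiples of \<open>z\<close> have square zero.\<close>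

lemma square_nonzero:
  assumes x: "x \<notin> leib_kernel s b"
  shows "b x x \<noteq> 0"
proof
  assume sq: "b x x = 0"
  have S: "leib_subalgebra s b (span {x})"
    using subalgebra_square[of x] sq by (simp add: insert_commute)
  have xK: "x \<notin> K" using x sq square_zero_multiple_z by (auto simp: kernel_eq)
  have zx: "z \<notin> span {x}"
  proof
    assume "z \<in> span {x}"
    then obtain \<alpha> where "z = s \<alpha> x" by (auto simp: in_span_single_iff)
    moreover from this have "\<alpha> \<noteq> 0" using z_nonzero by auto
    ultimately have "x = s (1 / \<alpha>) z" by simp
    then show False using x by (auto simp: kernel_eq in_span_single_iff)
  qed
  then have "\<not> self_idealizing b (span {x})"
    using self_idealizing_contains_central[OF S, of z] z_central by blast
  then have "leib_ideal s b (span {x})" using dichotomy S by blast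
  moreover have "leib_nilpotent s b (span {x})"
  proof (rule leib_nilpotentI)
    show "lc (span {x}) 1 \<subseteq> {0}"
      unfolding One_nat_def lower_central.simps
      by (intro bracket_span_minimal subspace_single_0)
        (auto simp: in_span_single_iff bracket_linear sq)
  qed simp
  ultimately show False using nilpotent_ideal_le xK span_base by blast
qed

text \<open>Subtracting from \<open>y\<close> the multiple of \<open>v\<close> with the same scalar
  leaves an element that acts by 0, hence lies in \<open>K\<close>.\<close>

lemma UNIV_eq: "UNIV = K + gen_subalgebra s b {v}"
proof -
  have "y \<in> K + gen_subalgebra s b {v}" for y
  proof -
    obtain \<xi> \<beta> where \<xi>: "b y x0 = s \<xi> x0 + s \<beta> z" using bracket_into_K[OF x0_in_K] by blast
    obtain \<delta> where \<delta>: "b v x0 = s 1 x0 + s \<delta> z" using v_x0 by blast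
    have "b (y - s \<xi> v) x0 = s (\<beta> - \<xi> * \<delta>) z"
      by (simp add: bracket_diff_left bracket_linear \<xi> \<delta> algebra_simps)
    then have "y - s \<xi> v \<in> K" by (rule zero_action_in_K)
    moreover have "s \<xi> v \<in> gen_subalgebra s b {v}"
      using gen_subalgebra_superset[of "{v}"]
      by (intro subspace_scale subspace_gen_subalgebra) simp
    ultimately have "(y - s \<xi> v) + s \<xi> v \<in> K + gen_subalgebra s b {v}" by (rule set_plus_intro)
    then show ?thesis by simp
  qed
  then show ?thesis by auto
qed

lemma coset_bracket_span_z:
  "coset_bracket b (span {z}) (x +o span {z}) (y +o span {z}) = b x y +o span {z}"
  by (rule coset_bracket_eq) (auto simp: in_span_single_iff bracket_linear intro: span_zero)

lemma strong_extraspecial_K: "strong_extraspecial s b K"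
  unfolding strong_extraspecial_def extraspecial_def
proof (intro conjI ballI)
  show "leib_subalgebra s b K" using K_ideal by (rule ideal_imp_subalgebra)
  show "dim (leib_center b K) = 1" unfolding center_K using z_nonzero by (rule dim_span_single)
  have "b x y +o span {z} = span {z}" if "x \<in> K" "y \<in> K" for x y
    using K_bracket_multiple_z[OF that] by (intro coset_of_element) (auto simp: in_span_single_iff)
  then show "quotient_abelian b K (leib_center b K)"
    by (auto simp: quotient_abelian_def center_K coset_bracket_span_z)
  show "b x x \<noteq> 0" if "x \<in> K - leib_center b K" for x
    using that square_zero_multiple_z by (auto simp: center_K)
qed

lemma coset_bracket_v:
  assumes "x \<in> K"
  shows "coset_bracket b (leib_center b K) (v +o leib_center b K) (x +o leib_center b K)
    = x +o leib_center b K"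
proof -
  obtain \<beta> where "b v x = x + s \<beta> z" using v_acts[OF assms] by blast
  moreover have "s \<beta> z +o span {z} = span {z}"
    by (intro coset_of_element) (auto simp: in_span_single_iff)
  ultimately show ?thesis
    by (simp add: center_K coset_bracket_span_z flip: set_plus_rearrange2)
qed

lemma v_square: "b v v \<noteq> 0"
  using square_nonzero kernel_le_K v_notin_K by blast

end

section \<open>Application to the locally nilpotent radical\<close>

theorem theoremB1:
  fixes s :: "'f::field \<Rightarrow> 'a::ab_group_add \<Rightarrow> 'a"
    and b :: "'a \<Rightarrow> 'a \<Rightarrow> 'a"
    and K :: "'a set"
  assumes "left_leibniz_algebra s b"
    and "\<not> is_lie b"
    and "\<forall>S. leib_subalgebra s b S \<longrightarrow> leib_ideal s b S \<or> self_idealizing b S"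
    and "K = ln_radical s b"
    and "K \<noteq> UNIV"
    and "\<not> is_cyclic s b K"
    and "\<not> is_abelian b K"
    and "bracket_span s b K K \<subseteq> leib_center b UNIV"
  shows "CHAR('f) = 2 \<and>
    (strong_extraspecial s b K \<and> (\<forall>x. x \<notin> leib_kernel s b \<longrightarrow> b x x \<noteq> 0)) \<and>
    (bracket_span s b K K = leib_center b UNIV \<and> leib_center b UNIV = leib_kernel s b) \<and>
    (leib_ideal s b (leib_kernel s b) \<and> vector_space.dim s (leib_kernel s b) = 1 \<and>
     (\<forall>z. leib_kernel s b = module.span s {z} \<longrightarrow>
       (\<exists>v. UNIV = K + gen_subalgebra s b {v} \<and>
            (\<exists>\<eta>. \<eta> \<noteq> 0 \<and> b v v = s \<eta> z) \<and>
            (\<forall>x \<in> K - leib_center b K.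
               coset_bracket b (leib_center b K) (v +o leib_center b K) (x +o leib_center b K)
               = x +o leib_center b K))))"
proof -
  interpret L: left_leibniz_algebra s b by fact
  note radical = L.ln_radical_eq[OF assms(3)]
  interpret proper_central_derived_radical s b K
  proof
    show "leib_ideal s b K" using radical(2) assms(4) by simp
    show "I \<subseteq> K" if "leib_ideal s b I" "leib_nilpotent s b I" for I
      using radical(1) assms(4) that by blast
  qed (use assms in blast)+
  have "CHAR('f) = 2"
    using two_eq_zero by (intro CHAR_eq_posI) (auto simp: less_2_cases_iff)
  moreover have "\<exists>v. UNIV = K + gen_subalgebra s b {v} \<and> (\<exists>\<eta>. \<eta> \<noteq> 0 \<and> b v v = s \<eta> w) \<and>
      (\<forall>x \<in> K - leib_center b K.
         coset_bracket b (leib_center b K) (v +o leib_center b K) (x +o leib_center b K)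
         = x +o leib_center b K)"
    if w: "leib_kernel s b = L.span {w}" for w
  proof (rule exI[of _ v], intro conjI)
    show "UNIV = K + gen_subalgebra s b {v}" by (rule UNIV_eq)
    \<comment> \<open>The generator \<open>w\<close> is arbitrary, so the coefficient is taken
      relative to it; it is nonzero because \<open>v\<close> lies outside \<open>K\<close> and hence
      has nonzero square.\<close>
    obtain \<eta> where "b v v = s \<eta> w"
      using L.square_in_kernel[of v] w L.in_span_single_iff by blast
    then show "\<exists>\<eta>. \<eta> \<noteq> 0 \<and> b v v = s \<eta> w" using v_square by auto
  qed (use coset_bracket_v in blast)
  ultimately show ?thesis
    using strong_extraspecial_K square_nonzero derived_K center_UNIV kernel_eq L.kernel_ideal
      L.dim_span_single[OF z_nonzero] by (simp del: L.dim_span)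
qed

end
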